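(* Let $$G=\langle a,b,t\mid a^2=b^2=t^3=e,\ ab=ba,\ t^{-1}at=b,\ t^{-1}bt=ab\rangle$$ and let $A=\{e,b,t\}$. Then $$i\bigl(\operatorname{Cay}(G,\partial A)\bigr)=2\qquad\text{and}\qquad \alpha\bigl(\operatorname{Cay}(G,\partial A)\bigr)=3 .$$
   Context: For a non-empty subset $A$ of a group $G$ with identity $e$, $\partial A=A^{-1}A\setminus\{e\}$, where $A^{-1}A=\{x^{-1}y\mid x,y\in A\}$. For a subset $S\subseteq G$ with $e\notin S$ and $S=S^{-1}$, the (left) Cayley graph $\operatorname{Cay}(G,S)$ is the simple graph with vertex set $G$ in which $u,v$ are adjacent if and only if $vu^{-1}\in S$. For a finite graph $\Gamma$, $\alpha(\Gamma)$ is the size of a largest independent set and $i(\Gamma)$ is the size of a smallest maximal (with respect to inclusion) independent set. *)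

theory Defs
  imports "HOL-Algebra.Coset" "HOL-Algebra.Generated_Groups" "Graph_Theory.Pair_Digraph"
begin

section \<open>Groups given by generators and relations\<close>

text \<open>A letter \<open>(x, True)\<close> stands for the generator \<open>x\<close>, and \<open>(x, False)\<close> for its formal
  inverse. The relation \<open>l = r\<close> is the pair \<open>(l, r)\<close> of words.\<close>

type_synonym 'x word = "('x \<times> bool) list"

inductive word_equiv :: "('x word \<times> 'x word) set \<Rightarrow> 'x word \<Rightarrow> 'x word \<Rightarrow> bool"
  for R where
  refl: "word_equiv R w w"
| sym: "word_equiv R v w \<Longrightarrow> word_equiv R w v"
| trans: "word_equiv R u v \<Longrightarrow> word_equiv R v w \<Longrightarrow> word_equiv R u w"
| cancel: "word_equiv R (u @ [(x, s), (x, \<not> s)] @ v) (u @ v)"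
| relation: "(l, r) \<in> R \<Longrightarrow> word_equiv R (u @ l @ v) (u @ r @ v)"

definition word_rel :: "('x word \<times> 'x word) set \<Rightarrow> ('x word \<times> 'x word) set" where
  "word_rel R = {(u, v). word_equiv R u v}"

definition word_class :: "('x word \<times> 'x word) set \<Rightarrow> 'x word \<Rightarrow> 'x word set" where
  "word_class R w = word_rel R `` {w}"

text \<open>The set of generators is the whole type \<open>'x\<close>.\<close>

definition presented_group :: "('x word \<times> 'x word) set \<Rightarrow> 'x word set monoid" where
  "presented_group R =
    \<lparr> carrier = UNIV // word_rel R,
      monoid.mult = (\<lambda>X Y. \<Union>u\<in>X. \<Union>v\<in>Y. word_class R (u @ v)),
      one = word_class R [] \<rparr>"

abbreviation gen :: "'x \<Rightarrow> 'x word" where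
  "gen x \<equiv> [(x, True)]"

abbreviation gen_inv :: "'x \<Rightarrow> 'x word" where
  "gen_inv x \<equiv> [(x, False)]"

definition presented_gen :: "('x word \<times> 'x word) set \<Rightarrow> 'x \<Rightarrow> 'x word set" where
  "presented_gen R x = word_class R (gen x)"

lemma equiv_word_rel: "equiv UNIV (word_rel R)"
proof (rule equivI)
  show "sym (word_rel R)" by (rule symI) (simp add: word_rel_def word_equiv.sym)
  show "trans (word_rel R)"
    by (rule transI) (simp add: word_rel_def, rule word_equiv.trans)
qed (auto simp: word_rel_def refl_on_def word_equiv.refl)

lemma word_class_eq_iff: "word_class R u = word_class R v \<longleftrightarrow> word_equiv R u v"
  using eq_equiv_class_iff[OF equiv_word_rel, of u v R]
  by (simp add: word_class_def word_rel_def)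

lemma word_class_self: "w \<in> word_class R w"
  by (simp add: word_class_def word_rel_def word_equiv.refl)

lemma carrier_presented_group: "carrier (presented_group R) = range (word_class R)"
  by (auto simp: presented_group_def quotient_def word_class_def)

lemma one_presented_group: "\<one>\<^bsub>presented_group R\<^esub> = word_class R []"
  by (simp add: presented_group_def)

lemma word_equiv_context: "word_equiv R u v \<Longrightarrow> word_equiv R (p @ u @ q) (p @ v @ q)"
proof (induction rule: word_equiv.induct)
  case (cancel u x s v)
  show ?case using word_equiv.cancel[of R "p @ u" x s "v @ q"] by simp
next
  case (relation l r u v)
  then show ?case using word_equiv.relation[of l r R "p @ u" "v @ q"] by simp
next
  case (refl w)
  show ?case by (rule word_equiv.refl)
next
  case (sym v w)
  from sym.IH show ?case by (rule word_equiv.sym)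
next
  case (trans u v w)
  from trans.IH show ?case by (rule word_equiv.trans)
qed

lemma word_equiv_append:
  assumes "word_equiv R u u'" and "word_equiv R v v'"
  shows "word_equiv R (u @ v) (u' @ v')"
proof (rule word_equiv.trans)
  show "word_equiv R (u @ v) (u' @ v)"
    using word_equiv_context[OF assms(1), of "[]" v] by simp
  show "word_equiv R (u' @ v) (u' @ v')"
    using word_equiv_context[OF assms(2), of u' "[]"] by simp
qed

lemma mult_presented_group:
  "word_class R u \<otimes>\<^bsub>presented_group R\<^esub> word_class R v = word_class R (u @ v)"
proof -
  have "word_class R (u' @ v') = word_class R (u @ v)"
    if "u' \<in> word_class R u" "v' \<in> word_class R v" for u' v'
  proof -
    from that have "word_equiv R u u'" "word_equiv R v v'"
      by (simp_all add: word_class_def word_rel_def)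
    from word_equiv.sym[OF word_equiv_append[OF this]] show ?thesis
      by (simp add: word_class_eq_iff)
  qed
  then have "(\<Union>u'\<in>word_class R u. \<Union>v'\<in>word_class R v. word_class R (u' @ v')) =
      (\<Union>u'\<in>word_class R u. \<Union>v'\<in>word_class R v. word_class R (u @ v))"
    by (intro SUP_cong HOL.refl)
  also have "\<dots> = word_class R (u @ v)"
    using word_class_self[of u R] word_class_self[of v R] by (simp only: UN_constant) auto
  finally show ?thesis by (simp only: presented_group_def monoid.simps)
qed

definition word_inv :: "'x word \<Rightarrow> 'x word" where
  "word_inv w = rev (map (\<lambda>(x, s). (x, \<not> s)) w)"

lemma word_equiv_inv: "word_equiv R (word_inv w @ w) []"
proof (induction w)
  case Nil
  show ?case by (simp add: word_inv_def word_equiv.refl)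
next
  case (Cons l w)
  obtain x s where l: "l = (x, s)" by (cases l)
  have "word_equiv R (word_inv w @ [(x, \<not> s), (x, \<not> \<not> s)] @ w) (word_inv w @ w)"
    by (rule word_equiv.cancel)
  from word_equiv.trans[OF this Cons.IH] show ?case by (simp add: l word_inv_def)
qed

theorem group_presented_group: "group (presented_group R)"
proof (rule groupI)
  show "\<one>\<^bsub>presented_group R\<^esub> \<in> carrier (presented_group R)"
    unfolding carrier_presented_group one_presented_group by (rule rangeI)
next
  fix X Y assume "X \<in> carrier (presented_group R)" "Y \<in> carrier (presented_group R)"
  then obtain u v where "X = word_class R u" "Y = word_class R v"
    unfolding carrier_presented_group by blast
  then show "X \<otimes>\<^bsub>presented_group R\<^esub> Y \<in> carrier (presented_group R)"
    by (simp only: carrier_presented_group mult_presented_group rangeI)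
next
  fix X Y Z
  assume "X \<in> carrier (presented_group R)" "Y \<in> carrier (presented_group R)"
    "Z \<in> carrier (presented_group R)"
  then obtain u v w where "X = word_class R u" "Y = word_class R v" "Z = word_class R w"
    unfolding carrier_presented_group by blast
  then show "X \<otimes>\<^bsub>presented_group R\<^esub> Y \<otimes>\<^bsub>presented_group R\<^esub> Z =
      X \<otimes>\<^bsub>presented_group R\<^esub> (Y \<otimes>\<^bsub>presented_group R\<^esub> Z)"
    by (simp only: mult_presented_group append_assoc)
next
  fix X assume "X \<in> carrier (presented_group R)"
  then obtain w where X: "X = word_class R w"
    unfolding carrier_presented_group by blast
  show "\<one>\<^bsub>presented_group R\<^esub> \<otimes>\<^bsub>presented_group R\<^esub> X = X"
    by (simp only: X one_presented_group mult_presented_group append_Nil)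
  have "word_class R (word_inv w) \<otimes>\<^bsub>presented_group R\<^esub> X = \<one>\<^bsub>presented_group R\<^esub>"
    by (simp only: X mult_presented_group one_presented_group word_class_eq_iff word_equiv_inv)
  then show "\<exists>Y\<in>carrier (presented_group R). Y \<otimes>\<^bsub>presented_group R\<^esub> X = \<one>\<^bsub>presented_group R\<^esub>"
    by (rule bexI) (simp only: carrier_presented_group rangeI)
qed

lemma presented_gen_closed: "presented_gen R x \<in> carrier (presented_group R)"
  by (simp only: presented_gen_def carrier_presented_group rangeI)

definition word_eval :: "('h, 'm) monoid_scheme \<Rightarrow> ('x \<Rightarrow> 'h) \<Rightarrow> 'x word \<Rightarrow> 'h" where
  "word_eval H f w = foldr (\<lambda>(x, s) y. (if s then f x else inv\<^bsub>H\<^esub> f x) \<otimes>\<^bsub>H\<^esub> y) w \<one>\<^bsub>H\<^esub>"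

context group
begin

lemma word_eval_closed:
  assumes "\<And>x. f x \<in> carrier G"
  shows "word_eval G f w \<in> carrier G"
  by (induction w) (auto simp: word_eval_def assms)

lemma word_eval_append:
  assumes "\<And>x. f x \<in> carrier G"
  shows "word_eval G f (u @ v) = word_eval G f u \<otimes> word_eval G f v"
proof (induction u)
  case Nil
  then show ?case using word_eval_closed[of f v] assms by (simp add: word_eval_def)
next
  case (Cons l u)
  obtain x s where "l = (x, s)" by (cases l)
  then show ?case
    using Cons word_eval_closed[of f u] word_eval_closed[of f v] assms
    by (simp add: word_eval_def m_assoc)
qed

lemma word_eval_word_equiv:
  assumes "word_equiv R u v"
    and f: "\<And>x. f x \<in> carrier G"
    and R: "\<And>l r. (l, r) \<in> R \<Longrightarrow> word_eval G f l = word_eval G f r"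
  shows "word_eval G f u = word_eval G f v"
  using assms(1)
proof (induction rule: word_equiv.induct)
  case (cancel u x s v)
  have "word_eval G f [(x, s), (x, \<not> s)] = \<one>"
    using f by (simp add: word_eval_def)
  then show ?case
    by (simp add: word_eval_append[OF f, where u = u]
        word_eval_append[OF f, where u = "[(x, s), (x, \<not> s)]"]
        word_eval_closed[OF f] del: append_Cons)
next
  case (relation l r u v)
  then show ?case by (simp add: word_eval_append[OF f] R)
qed simp_all

end

text \<open>In \<open>presented_group R\<close> words evaluate to their classes, the generators generate, the
  relations \<open>R\<close> hold, and every assignment of the generators that respects \<open>R\<close> extends to a
  homomorphism.\<close>

lemma word_eval_presented_group:
  "word_eval (presented_group R) (presented_gen R) w = word_class R w"
proof (induction w)
  case Nil
  show ?case by (simp add: word_eval_def one_presented_group)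
next
  case (Cons l w)
  interpret group "presented_group R" by (rule group_presented_group)
  obtain x s where l: "l = (x, s)" by (cases l)
  have "word_equiv R ([] @ [(x, False), (x, \<not> False)] @ []) ([] @ [])"
    by (rule word_equiv.cancel)
  then have "word_class R (gen_inv x) \<otimes>\<^bsub>presented_group R\<^esub> presented_gen R x = \<one>\<^bsub>presented_group R\<^esub>"
    by (simp add: presented_gen_def mult_presented_group one_presented_group word_class_eq_iff)
  then have "inv\<^bsub>presented_group R\<^esub> presented_gen R x = word_class R (gen_inv x)"
    by (rule inv_equality) (simp_all add: presented_gen_closed, simp add: carrier_presented_group)
  then show ?case
    using Cons by (cases s) (auto simp: l word_eval_def presented_gen_def mult_presented_group)
qed

theorem presented_group_relation:
  "(l, r) \<in> R \<Longrightarrow> word_eval (presented_group R) (presented_gen R) l =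
    word_eval (presented_group R) (presented_gen R) r"
  using word_equiv.relation[of l r R "[]" "[]"]
  by (simp add: word_eval_presented_group word_class_eq_iff)

theorem generate_presented_group:
  "generate (presented_group R) (range (presented_gen R)) = carrier (presented_group R)"
proof -
  interpret group "presented_group R" by (rule group_presented_group)
  have "word_class R w \<in> generate (presented_group R) (range (presented_gen R))" for w
  proof (induction w)
    case Nil
    show ?case
      using generate.one[of "presented_group R"] by (simp add: one_presented_group)
  next
    case (Cons l w)
    obtain x s where l: "l = (x, s)" by (cases l)
    have "(if s then presented_gen R x else inv\<^bsub>presented_group R\<^esub> presented_gen R x)
        \<in> generate (presented_group R) (range (presented_gen R))"
      by (auto intro: generate.incl generate.inv)
    from generate.eng[OF this Cons] show ?case
      unfolding word_eval_presented_group[symmetric] by (simp add: l word_eval_def)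
  qed
  moreover have "generate (presented_group R) (range (presented_gen R)) \<subseteq> carrier (presented_group R)"
    by (rule generate_incl) (auto simp: presented_gen_closed)
  ultimately show ?thesis by (auto simp: carrier_presented_group)
qed

theorem presented_group_universal:
  assumes "group H" and f: "\<And>x. f x \<in> carrier H"
    and R: "\<And>l r. (l, r) \<in> R \<Longrightarrow> word_eval H f l = word_eval H f r"
  shows "\<exists>h \<in> hom (presented_group R) H. \<forall>x. h (presented_gen R x) = f x"
proof -
  interpret H: group H by fact
  define h where "h X = word_eval H f (SOME w. w \<in> X)" for X
  have h: "h (word_class R w) = word_eval H f w" for w
  proof -
    have "(SOME v. v \<in> word_class R w) \<in> word_class R w"
      by (rule someI) (rule word_class_self)
    then have "word_equiv R w (SOME v. v \<in> word_class R w)"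
      unfolding word_class_def word_rel_def by simp
    from H.word_eval_word_equiv[OF this f R] show ?thesis by (simp add: h_def)
  qed
  have "h \<in> hom (presented_group R) H"
    by (rule homI)
       (auto simp: carrier_presented_group h mult_presented_group H.word_eval_closed[OF f]
         H.word_eval_append[OF f])
  moreover have "h (presented_gen R x) = f x" for x
    using f by (simp add: presented_gen_def h word_eval_def)
  ultimately show ?thesis by blast
qed


section \<open>Cayley graphs\<close>

definition quotient_boundary :: "('a, 'm) monoid_scheme \<Rightarrow> 'a set \<Rightarrow> 'a set" (\<open>\<partial>\<index> _\<close> [81] 80)
  where "\<partial>\<^bsub>G\<^esub> A = (set_inv\<^bsub>G\<^esub> A <#>\<^bsub>G\<^esub> A) - {\<one>\<^bsub>G\<^esub>}"

text \<open>A simple graph is a symmetric loop-free set of pairs of vertices, each edge \<open>{u, v}\<close> being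
  represented by both \<open>(u, v)\<close> and \<open>(v, u)\<close>.\<close>

definition cayley_graph :: "('a, 'm) monoid_scheme \<Rightarrow> 'a set \<Rightarrow> 'a pair_pre_digraph" where
  "cayley_graph G S =
    \<lparr> pverts = carrier G,
      parcs = {(u, v). u \<in> carrier G \<and> v \<in> carrier G \<and> v \<otimes>\<^bsub>G\<^esub> inv\<^bsub>G\<^esub> u \<in> S} \<rparr>"

context group
begin

lemma quotient_boundary_connection_set:
  assumes "A \<subseteq> carrier G"
  shows "\<partial>\<^bsub>G\<^esub> A \<subseteq> carrier G" and "\<one> \<notin> \<partial>\<^bsub>G\<^esub> A" and "set_inv (\<partial>\<^bsub>G\<^esub> A) = \<partial>\<^bsub>G\<^esub> A"
proof -
  show sub: "\<partial>\<^bsub>G\<^esub> A \<subseteq> carrier G"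
    using assms by (auto simp: quotient_boundary_def set_mult_def SET_INV_def)
  show "\<one> \<notin> \<partial>\<^bsub>G\<^esub> A" by (simp add: quotient_boundary_def)
  have inv_mem: "inv z \<in> \<partial>\<^bsub>G\<^esub> A" if z: "z \<in> \<partial>\<^bsub>G\<^esub> A" for z
  proof -
    from z obtain x y where xy: "x \<in> A" "y \<in> A" "z = inv x \<otimes> y"
      by (auto simp: quotient_boundary_def set_mult_def SET_INV_def)
    moreover from this have "x \<in> carrier G" "y \<in> carrier G" using assms by blast+
    ultimately have eq: "inv z = inv y \<otimes> x" by (simp add: inv_mult_group)
    have "z \<in> carrier G" and "z \<noteq> \<one>" using z sub by (auto simp: quotient_boundary_def)
    then have "inv z \<noteq> \<one>" by simp
    then show ?thesis
      using xy(1,2) unfolding quotient_boundary_def set_mult_def SET_INV_def eq by blast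
  qed
  show "set_inv (\<partial>\<^bsub>G\<^esub> A) = \<partial>\<^bsub>G\<^esub> A"
  proof
    show "set_inv (\<partial>\<^bsub>G\<^esub> A) \<subseteq> \<partial>\<^bsub>G\<^esub> A" using inv_mem by (auto simp: SET_INV_def)
    show "\<partial>\<^bsub>G\<^esub> A \<subseteq> set_inv (\<partial>\<^bsub>G\<^esub> A)"
    proof
      fix z assume z: "z \<in> \<partial>\<^bsub>G\<^esub> A"
      with sub have "z \<in> carrier G" by blast
      then have "z = inv (inv z)" by simp
      with inv_mem[OF z] show "z \<in> set_inv (\<partial>\<^bsub>G\<^esub> A)" unfolding SET_INV_def by blast
    qed
  qed
qed

lemma cayley_graph_simple:
  assumes "\<one> \<notin> S" and "set_inv S = S"
  shows "pair_bidirected_digraph (cayley_graph G S)"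
proof -
  have "u \<otimes> inv v \<in> S" if "u \<in> carrier G" "v \<in> carrier G" "v \<otimes> inv u \<in> S" for u v
  proof -
    have "inv (v \<otimes> inv u) \<in> set_inv S" using that unfolding SET_INV_def by blast
    then show ?thesis using that assms by (simp add: inv_mult_group)
  qed
  then show ?thesis
    using assms(1)
    by unfold_locales (auto simp: cayley_graph_def symmetric_def intro!: symI)
qed

end


section \<open>Independent sets\<close>

definition independent_set :: "'a pair_pre_digraph \<Rightarrow> 'a set \<Rightarrow> bool" where
  "independent_set \<Gamma> I \<longleftrightarrow> I \<subseteq> pverts \<Gamma> \<and> (\<forall>u\<in>I. \<forall>v\<in>I. (u, v) \<notin> parcs \<Gamma>)"

definition maximal_independent_set :: "'a pair_pre_digraph \<Rightarrow> 'a set \<Rightarrow> bool" where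
  "maximal_independent_set \<Gamma> I \<longleftrightarrow>
    independent_set \<Gamma> I \<and> (\<forall>J. independent_set \<Gamma> J \<and> I \<subseteq> J \<longrightarrow> J = I)"

text \<open>The following two numbers are meaningful for finite graphs only.\<close>

definition independence_number :: "'a pair_pre_digraph \<Rightarrow> nat" where
  "independence_number \<Gamma> = Max (card ` {I. independent_set \<Gamma> I})"

definition independent_domination_number :: "'a pair_pre_digraph \<Rightarrow> nat" where
  "independent_domination_number \<Gamma> = Min (card ` {I. maximal_independent_set \<Gamma> I})"


section \<open>The group under consideration\<close>

datatype letter = ga | gb | gt

definition G_relations :: "(letter word \<times> letter word) set" where
  "G_relations =
    { (gen ga @ gen ga, []),
      (gen gb @ gen gb, []),
      (gen gt @ gen gt @ gen gt, []),
      (gen ga @ gen gb, gen gb @ gen ga),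
      (gen_inv gt @ gen ga @ gen gt, gen gb),
      (gen_inv gt @ gen gb @ gen gt, gen ga @ gen gb) }"

end

theory Submission
  imports Defs
begin

text \<open>Every element of \<open>G\<close> has a unique normal form \<open>t\<^sup>i a\<^sup>x b\<^sup>y\<close>, which identifies \<open>G\<close> with a
  semidirect product of the Klein four-group and the cyclic group of order three. There
  \<open>\<partial>A = {b, t, tab, t\<^sup>2, t\<^sup>2b}\<close>, and right translations are automorphisms of the Cayley graph, so
  only independent sets containing \<open>e\<close> matter. The six other elements that are not adjacent to
  \<open>e\<close> induce a wheel with hub \<open>a\<close> over a 5-cycle: \<open>{e, a}\<close> is maximal, and at most two elements
  can be added to \<open>e\<close>.\<close>

section \<open>Isomorphic graphs\<close>

lemma independent_set_subset: "independent_set \<Gamma> I \<Longrightarrow> I \<subseteq> pverts \<Gamma>"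
  by (simp add: independent_set_def)

lemma maximal_independent_set_subset: "maximal_independent_set \<Gamma> I \<Longrightarrow> I \<subseteq> pverts \<Gamma>"
  by (simp add: maximal_independent_set_def independent_set_def)

lemma independent_set_graph_iso:
  assumes f: "bij_betw f (pverts \<Gamma>) (pverts \<Delta>)"
    and arcs: "\<And>u v. u \<in> pverts \<Gamma> \<Longrightarrow> v \<in> pverts \<Gamma> \<Longrightarrow>
      (f u, f v) \<in> parcs \<Delta> \<longleftrightarrow> (u, v) \<in> parcs \<Gamma>"
    and I: "I \<subseteq> pverts \<Gamma>"
  shows "independent_set \<Delta> (f ` I) \<longleftrightarrow> independent_set \<Gamma> I"
proof -
  have "f ` I \<subseteq> pverts \<Delta>" using I image_mono[OF I, of f] bij_betw_imp_surj_on[OF f] by simp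
  moreover have "(\<forall>u\<in>I. \<forall>v\<in>I. (f u, f v) \<notin> parcs \<Delta>) \<longleftrightarrow> (\<forall>u\<in>I. \<forall>v\<in>I. (u, v) \<notin> parcs \<Gamma>)"
    using subsetD[OF I] arcs by (intro ball_cong HOL.refl) simp
  ultimately show ?thesis using I by (simp add: independent_set_def)
qed

lemma maximal_independent_set_graph_iso:
  assumes f: "bij_betw f (pverts \<Gamma>) (pverts \<Delta>)"
    and arcs: "\<And>u v. u \<in> pverts \<Gamma> \<Longrightarrow> v \<in> pverts \<Gamma> \<Longrightarrow>
      (f u, f v) \<in> parcs \<Delta> \<longleftrightarrow> (u, v) \<in> parcs \<Gamma>"
    and I: "I \<subseteq> pverts \<Gamma>"
  shows "maximal_independent_set \<Delta> (f ` I) \<longleftrightarrow> maximal_independent_set \<Gamma> I"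
proof -
  have inj: "inj_on f (pverts \<Gamma>)" and img: "f ` pverts \<Gamma> = pverts \<Delta>"
    using f by (auto simp: bij_betw_def)
  have subset: "f ` I \<subseteq> f ` J \<longleftrightarrow> I \<subseteq> J" if "J \<subseteq> pverts \<Gamma>" for J
    using inj_on_image_mem_iff[OF inj _ that] I unfolding image_subset_iff by blast
  \<comment> \<open>An independent set consists of vertices, so the quantifier can be bounded. Every
    vertex set of \<open>\<Delta>\<close> is the image of one of \<open>\<Gamma>\<close>, which
    pulls the quantifier back along \<open>f\<close>.\<close>
  have "(\<forall>J. independent_set \<Delta> J \<and> f ` I \<subseteq> J \<longrightarrow> J = f ` I) \<longleftrightarrow>
      (\<forall>J\<subseteq>pverts \<Delta>. independent_set \<Delta> J \<and> f ` I \<subseteq> J \<longrightarrow> J = f ` I)"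
    using independent_set_subset by blast
  also have "\<dots> \<longleftrightarrow>
      (\<forall>J\<subseteq>pverts \<Gamma>. independent_set \<Delta> (f ` J) \<and> f ` I \<subseteq> f ` J \<longrightarrow> f ` J = f ` I)"
    unfolding img[symmetric] all_subset_image ..
  also have "\<dots> \<longleftrightarrow> (\<forall>J\<subseteq>pverts \<Gamma>. independent_set \<Gamma> J \<and> I \<subseteq> J \<longrightarrow> J = I)"
    using independent_set_graph_iso[OF f arcs] inj_on_image_eq_iff[OF inj _ I] subset
    by (intro all_cong1 imp_cong HOL.refl) simp_all
  also have "\<dots> \<longleftrightarrow> (\<forall>J. independent_set \<Gamma> J \<and> I \<subseteq> J \<longrightarrow> J = I)"
    using independent_set_subset by blast
  finally show ?thesis
    using independent_set_graph_iso[OF f arcs I] by (simp add: maximal_independent_set_def)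
qed

text \<open>Taking images under \<open>f\<close> is a cardinality-preserving bijection between the
  two families. The predicates stay abstract so that one argument serves both independent and
  maximal independent sets.\<close>

lemma card_image_Collect_transfer:
  assumes f: "bij_betw f V W"
    and P: "\<And>I. P I \<Longrightarrow> I \<subseteq> V" and Q: "\<And>J. Q J \<Longrightarrow> J \<subseteq> W"
    and PQ: "\<And>I. I \<subseteq> V \<Longrightarrow> Q (f ` I) \<longleftrightarrow> P I"
  shows "card ` {J. Q J} = card ` {I. P I}"
proof -
  have inj: "inj_on f V" and img: "f ` V = W" using f by (auto simp: bij_betw_def)
  have "{J. Q J} = (`) f ` {I. P I}"
  proof (intro equalityI subsetI)
    fix J assume "J \<in> {J. Q J}"
    then have "Q J" by simp
    then obtain I where "I \<subseteq> V" "J = f ` I" using Q img by (metis subset_image_iff)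
    with \<open>Q J\<close> PQ show "J \<in> (`) f ` {I. P I}" by blast
  qed (use P PQ in blast)
  moreover have "card (f ` I) = card I" if "P I" for I
    using inj_on_subset[OF inj P[OF that]] by (rule card_image)
  ultimately show ?thesis by (force simp: image_iff)
qed

lemma graph_iso_numbers:
  assumes f: "bij_betw f (pverts \<Gamma>) (pverts \<Delta>)"
    and arcs: "\<And>u v. u \<in> pverts \<Gamma> \<Longrightarrow> v \<in> pverts \<Gamma> \<Longrightarrow>
      (f u, f v) \<in> parcs \<Delta> \<longleftrightarrow> (u, v) \<in> parcs \<Gamma>"
  shows "independence_number \<Delta> = independence_number \<Gamma>"
    and "independent_domination_number \<Delta> = independent_domination_number \<Gamma>"
proof -
  have "card ` {J. independent_set \<Delta> J} = card ` {I. independent_set \<Gamma> I}"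
    by (rule card_image_Collect_transfer[OF f])
      (use independent_set_graph_iso[OF f arcs] independent_set_subset in blast)+
  then show "independence_number \<Delta> = independence_number \<Gamma>"
    by (simp add: independence_number_def)
  have "card ` {J. maximal_independent_set \<Delta> J} = card ` {I. maximal_independent_set \<Gamma> I}"
    by (rule card_image_Collect_transfer[OF f])
      (use maximal_independent_set_graph_iso[OF f arcs] maximal_independent_set_subset in blast)+
  then show "independent_domination_number \<Delta> = independent_domination_number \<Gamma>"
    by (simp add: independent_domination_number_def)
qed

section \<open>Boundaries and Cayley graphs under group isomorphisms\<close>

lemma quotient_boundary_eq:
  "\<partial>\<^bsub>G\<^esub> A = (\<Union>x\<in>A. \<Union>y\<in>A. {inv\<^bsub>G\<^esub> x \<otimes>\<^bsub>G\<^esub> y}) - {\<one>\<^bsub>G\<^esub>}"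
  by (simp add: quotient_boundary_def set_mult_def SET_INV_def)

lemma quotient_boundary_iso:
  assumes "group G" and "group H" and f: "f \<in> iso G H" and A: "A \<subseteq> carrier G"
  shows "\<partial>\<^bsub>H\<^esub> (f ` A) = f ` (\<partial>\<^bsub>G\<^esub> A)"
proof -
  interpret group_hom G H f
    using assms by (simp add: group_hom_def group_hom_axioms_def iso_def)
  let ?Q = "\<Union>x\<in>A. \<Union>y\<in>A. {inv\<^bsub>G\<^esub> x \<otimes>\<^bsub>G\<^esub> y}"
  have "inj_on f (carrier G)" using f by (simp add: iso_def bij_betw_def)
  \<comment> \<open>Removing the identity commutes with taking images only because \<open>f\<close>
    is injective.\<close>
  then have "f ` (?Q - {\<one>\<^bsub>G\<^esub>}) = f ` ?Q - f ` {\<one>\<^bsub>G\<^esub>}"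
    by (rule inj_on_image_set_diff) (use A in auto)
  moreover have "f ` ?Q = (\<Union>x\<in>A. \<Union>y\<in>A. {inv\<^bsub>H\<^esub> f x \<otimes>\<^bsub>H\<^esub> f y})"
    using subsetD[OF A] by (simp add: image_UN)
  ultimately show ?thesis by (simp add: quotient_boundary_eq)
qed

text \<open>A group isomorphism carries the quotient v u^-1 to the quotient of the images. Being
  injective, it also reflects membership in \<open>S\<close>, and is therefore a graph
  isomorphism.\<close>

lemma cayley_graph_iso:
  assumes "group G" and "group H" and f: "f \<in> iso G H" and S: "S \<subseteq> carrier G"
  shows "independence_number (cayley_graph H (f ` S)) = independence_number (cayley_graph G S)"
    and "independent_domination_number (cayley_graph H (f ` S)) =
      independent_domination_number (cayley_graph G S)"
proof -
  interpret group_hom G H f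
    using assms by (simp add: group_hom_def group_hom_axioms_def iso_def)
  have bij: "bij_betw f (pverts (cayley_graph G S)) (pverts (cayley_graph H (f ` S)))"
    using f by (simp add: cayley_graph_def iso_def)
  have arcs: "(f u, f v) \<in> parcs (cayley_graph H (f ` S)) \<longleftrightarrow> (u, v) \<in> parcs (cayley_graph G S)"
    if "u \<in> pverts (cayley_graph G S)" "v \<in> pverts (cayley_graph G S)" for u v
  proof -
    from that have uv: "u \<in> carrier G" "v \<in> carrier G" by (simp_all add: cayley_graph_def)
    have "f v \<otimes>\<^bsub>H\<^esub> inv\<^bsub>H\<^esub> f u = f (v \<otimes>\<^bsub>G\<^esub> inv\<^bsub>G\<^esub> u)" using uv by simp
    moreover have "f (v \<otimes>\<^bsub>G\<^esub> inv\<^bsub>G\<^esub> u) \<in> f ` S \<longleftrightarrow> v \<otimes>\<^bsub>G\<^esub> inv\<^bsub>G\<^esub> u \<in> S"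
      using f uv S by (intro inj_on_image_mem_iff[of f "carrier G"]) (auto simp: iso_def bij_betw_def)
    ultimately show ?thesis using uv by (simp add: cayley_graph_def)
  qed
  show "independence_number (cayley_graph H (f ` S)) = independence_number (cayley_graph G S)"
    and "independent_domination_number (cayley_graph H (f ` S)) =
      independent_domination_number (cayley_graph G S)"
    by (rule graph_iso_numbers[OF bij arcs]; assumption)+
qed


section \<open>The semidirect product\<close>

text \<open>The exponents of t modulo 3, as a datatype so that identities between normal forms
  become finite case splits.\<close>

datatype z3 = Z0 | Z1 | Z2

fun add3 :: "z3 \<Rightarrow> z3 \<Rightarrow> z3" where
  "add3 Z0 j = j"
| "add3 i Z0 = i"
| "add3 Z1 Z1 = Z2"
| "add3 Z1 Z2 = Z0"
| "add3 Z2 Z1 = Z0"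
| "add3 Z2 Z2 = Z1"

text \<open>\<open>conj3 j v\<close> is \<open>t\<^sup>-\<^sup>j v t\<^sup>j\<close>, where \<open>(x, y)\<close> encodes \<open>a\<^sup>x b\<^sup>y\<close>.\<close>

fun conj3 :: "z3 \<Rightarrow> bool \<times> bool \<Rightarrow> bool \<times> bool" where
  "conj3 Z0 v = v"
| "conj3 Z1 (x, y) = (y, x \<noteq> y)"
| "conj3 Z2 (x, y) = (x \<noteq> y, x)"

text \<open>The triple \<open>(i, x, y)\<close> encodes \<open>t\<^sup>i a\<^sup>x b\<^sup>y\<close>.\<close>

type_synonym nform = "z3 \<times> bool \<times> bool"

text \<open>Moving t^j to the left past v turns v into t^-j v t^j. On the exponents of a and b,
  inequality of booleans is addition modulo 2.\<close>

fun nf_mult :: "nform \<Rightarrow> nform \<Rightarrow> nform" where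
  "nf_mult (i, v) (j, x, y) =
    (add3 i j, fst (conj3 j v) \<noteq> x, snd (conj3 j v) \<noteq> y)"

text \<open>Since v is an involution or trivial, (t^i v)^-1 = v t^-i, and t^-i then moves to the
  left.\<close>

fun nf_inv :: "nform \<Rightarrow> nform" where
  "nf_inv (Z0, v) = (Z0, v)"
| "nf_inv (Z1, v) = (Z2, conj3 Z2 v)"
| "nf_inv (Z2, v) = (Z1, conj3 Z1 v)"

definition nf_group :: "nform monoid" where
  "nf_group = \<lparr> carrier = UNIV, monoid.mult = nf_mult, one = (Z0, False, False) \<rparr>"

lemma nf_group_simps [simp]:
  "carrier nf_group = UNIV"
  "g \<otimes>\<^bsub>nf_group\<^esub> h = nf_mult g h"
  "\<one>\<^bsub>nf_group\<^esub> = (Z0, False, False)"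
  by (simp_all add: nf_group_def)

lemma add3_Z0 [simp]: "add3 i Z0 = i"
  by (cases i) simp_all

lemma conj3_one [simp]: "conj3 i (False, False) = (False, False)"
  by (cases i) simp_all

lemma nf_mult_assoc: "nf_mult (nf_mult g h) k = nf_mult g (nf_mult h k)"
proof -
  obtain i x y j x' y' l x'' y'' where
    "g = (i, x, y)" "h = (j, x', y')" "k = (l, x'', y'')"
    by (metis prod_cases3)
  then show ?thesis by (cases i; cases j; cases l) auto
qed

lemma nf_mult_inv: "nf_mult (nf_inv g) g = (Z0, False, False)"
proof -
  obtain i x y where "g = (i, x, y)" by (metis prod_cases3)
  then show ?thesis by (cases i) auto
qed

lemma group_nf_group: "group nf_group"
proof (rule groupI)
  fix g assume "g \<in> carrier nf_group"
  show "\<exists>h\<in>carrier nf_group. h \<otimes>\<^bsub>nf_group\<^esub> g = \<one>\<^bsub>nf_group\<^esub>"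
    by (rule bexI[of _ "nf_inv g"]) (simp_all add: nf_mult_inv)
qed (auto simp: nf_mult_assoc)

interpretation nf: group nf_group
  by (rule group_nf_group)

lemma inv_nf_group [simp]: "inv\<^bsub>nf_group\<^esub> g = nf_inv g"
  by (rule nf.inv_equality) (simp_all add: nf_mult_inv)

lemma all_z3: "(\<forall>i. P i) \<longleftrightarrow> P Z0 \<and> P Z1 \<and> P Z2"
  by (metis z3.exhaust)

lemmas all_nform = split_paired_All all_z3 all_bool_eq

section \<open>The isomorphism with the presented group\<close>

fun nf_eval :: "('g, 'm) monoid_scheme \<Rightarrow> 'g \<Rightarrow> 'g \<Rightarrow> 'g \<Rightarrow> nform \<Rightarrow> 'g" where
  "nf_eval G a b t (i, x, y) =
    (case i of Z0 \<Rightarrow> \<one>\<^bsub>G\<^esub> | Z1 \<Rightarrow> t | Z2 \<Rightarrow> t \<otimes>\<^bsub>G\<^esub> t) \<otimes>\<^bsub>G\<^esub>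
    ((if x then a else \<one>\<^bsub>G\<^esub>) \<otimes>\<^bsub>G\<^esub> (if y then b else \<one>\<^bsub>G\<^esub>))"

lemma (in group) nf_eval_hom:
  assumes c: "a \<in> carrier G" "b \<in> carrier G" "t \<in> carrier G"
    and rel: "a \<otimes> a = \<one>" "b \<otimes> b = \<one>" "t \<otimes> (t \<otimes> t) = \<one>" "a \<otimes> b = b \<otimes> a"
      "inv t \<otimes> (a \<otimes> t) = b" "inv t \<otimes> (b \<otimes> t) = a \<otimes> b"
  shows "nf_eval G a b t \<in> hom nf_group G"
proof -
  \<comment> \<open>The relations are oriented as rewrite rules that move t to the left and a in
    front of b. The versions in \<open>rel'\<close> carry a trailing factor \<open>z\<close>, so
    that they also apply inside products nested to the right.\<close>
  have at: "a \<otimes> t = t \<otimes> b" and bt: "b \<otimes> t = t \<otimes> (a \<otimes> b)"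
    using rel(5,6) c by (metis inv_solve_left m_closed)+
  have extend: "u \<otimes> (v \<otimes> z) = w \<otimes> z"
    if "u \<otimes> v = w" "u \<in> carrier G" "v \<in> carrier G" "z \<in> carrier G" for u v w z
    using that by (metis m_assoc)
  have rel': "a \<otimes> (a \<otimes> z) = z" "b \<otimes> (b \<otimes> z) = z" "t \<otimes> (t \<otimes> (t \<otimes> z)) = z"
      "b \<otimes> (a \<otimes> z) = a \<otimes> (b \<otimes> z)" "a \<otimes> (t \<otimes> z) = t \<otimes> (b \<otimes> z)"
      "b \<otimes> (t \<otimes> z) = t \<otimes> (a \<otimes> (b \<otimes> z))" if z: "z \<in> carrier G" for z
    using extend[OF rel(1)] extend[OF rel(2)] extend[OF rel(3)] extend[OF rel(4)[symmetric]]
      extend[OF at] extend[OF bt] c z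
    by (simp_all add: m_assoc)
  have closed: "nf_eval G a b t g \<in> carrier G" for g
    using c by (cases g) (auto split: z3.split)
  have "nf_eval G a b t (nf_mult g h) = nf_eval G a b t g \<otimes> nf_eval G a b t h" for g h
  proof -
    obtain i x y j x' y' where "g = (i, x, y)" "h = (j, x', y')" by (metis prod_cases3)
    then show ?thesis
      using c
      by (cases i; cases j; cases x; cases y; cases x'; cases y')
        (simp_all add: m_assoc rel(1-3) rel(4)[symmetric] at bt rel')
  qed
  with closed show ?thesis by (auto intro!: homI)
qed

text \<open>Translates between words and equations. One direction yields the relations in the
  presented group, the other feeds its universal property with \<open>nf_group\<close> as
  target.\<close>

lemma (in group) word_eval_G_relations:
  assumes "\<And>x. f x \<in> carrier G"
  shows "(\<forall>(l, r) \<in> G_relations. word_eval G f l = word_eval G f r) \<longleftrightarrow>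
    f ga \<otimes> f ga = \<one> \<and> f gb \<otimes> f gb = \<one> \<and> f gt \<otimes> (f gt \<otimes> f gt) = \<one> \<and>
    f ga \<otimes> f gb = f gb \<otimes> f ga \<and> inv f gt \<otimes> (f ga \<otimes> f gt) = f gb \<and>
    inv f gt \<otimes> (f gb \<otimes> f gt) = f ga \<otimes> f gb"
  using assms by (simp add: G_relations_def word_eval_def)

lemma nf_eval_iso: "nf_eval (presented_group G_relations) (presented_gen G_relations ga)
    (presented_gen G_relations gb) (presented_gen G_relations gt)
  \<in> iso nf_group (presented_group G_relations)"
proof -
  interpret P: group "presented_group G_relations" by (rule group_presented_group)
  let ?P = "presented_group G_relations"
  let ?a = "presented_gen G_relations ga" and ?b = "presented_gen G_relations gb"
    and ?t = "presented_gen G_relations gt"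
  let ?\<nu> = "nf_eval ?P ?a ?b ?t"
  note c = presented_gen_closed[of G_relations]
  have hom: "?\<nu> \<in> hom nf_group ?P"
    using P.word_eval_G_relations[of "presented_gen G_relations", OF c] presented_group_relation
    by (intro P.nf_eval_hom c) blast+
  then interpret \<nu>: group_hom nf_group ?P ?\<nu>
    by (simp add: group_hom_def group_hom_axioms_def group_nf_group P.group_axioms)
  \<comment> \<open>Surjectivity: the image is a subgroup that contains the generators.\<close>
  have "presented_gen G_relations x \<in> range ?\<nu>" for x
  proof (cases x)
    case ga
    then show ?thesis using c by (intro image_eqI[of _ _ "(Z0, True, False)"]) simp_all
  next
    case gb
    then show ?thesis using c by (intro image_eqI[of _ _ "(Z0, False, True)"]) simp_all
  next
    case gt
    then show ?thesis using c by (intro image_eqI[of _ _ "(Z1, False, False)"]) simp_all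
  qed
  moreover have "subgroup (range ?\<nu>) ?P" using \<nu>.img_is_subgroup by simp
  ultimately have "generate ?P (range (presented_gen G_relations)) \<subseteq> range ?\<nu>"
    by (intro P.generate_subgroup_incl) auto
  then have surj: "carrier ?P \<subseteq> range ?\<nu>" by (simp only: generate_presented_group)
  \<comment> \<open>Injectivity: the normal forms of a, b, t satisfy the relations, so the universal
    property gives a homomorphism \<open>h\<close> back to \<open>nf_group\<close>. It is a left
    inverse, as computing it on the twelve normal forms shows.\<close>
  define f where "f x = (case x of ga \<Rightarrow> (Z0, True, False) | gb \<Rightarrow> (Z0, False, True)
    | gt \<Rightarrow> (Z1, False, False))" for x
  have "\<exists>h\<in>hom ?P nf_group. \<forall>x. h (presented_gen G_relations x) = f x"
  proof (rule presented_group_universal[OF group_nf_group])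
    have "\<forall>(l, r) \<in> G_relations. word_eval nf_group f l = word_eval nf_group f r"
      by (subst nf.word_eval_G_relations) (simp_all add: f_def)
    then show "word_eval nf_group f l = word_eval nf_group f r" if "(l, r) \<in> G_relations" for l r
      using that by blast
  qed simp
  then obtain h where h: "h \<in> hom ?P nf_group" "\<And>x. h (presented_gen G_relations x) = f x"
    by blast
  interpret h: group_hom ?P nf_group h
    by (simp add: group_hom_def group_hom_axioms_def group_nf_group P.group_axioms h)
  have "\<forall>g. h (?\<nu> g) = g"
    using c h.hom_mult h.hom_one by (simp add: all_nform h(2) f_def)
  then have "inj ?\<nu>" by (metis injI)
  then show ?thesis
    using hom surj \<nu>.hom_closed by (auto simp: iso_def bij_betw_def simp del: nf_eval.simps)
qed


section \<open>Independent sets of the Cayley graph\<close>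

text \<open>In this order: b, t, b^-1 t = tab, t^-1 = t^2 and t^-1 b = t^2 b.\<close>

definition nf_boundary :: "nform set" where
  "nf_boundary =
    {(Z0, False, True), (Z1, False, False), (Z1, True, True), (Z2, False, False), (Z2, False, True)}"

lemma boundary_nf_group:
  "\<partial>\<^bsub>nf_group\<^esub> {(Z0, False, False), (Z0, False, True), (Z1, False, False)} = nf_boundary"
  by (simp add: quotient_boundary_eq nf_boundary_def insert_Diff_if insert_commute)

abbreviation nf_cayley :: "nform pair_pre_digraph" where
  "nf_cayley \<equiv> cayley_graph nf_group nf_boundary"

lemma independent_set_nf_cayley:
  "independent_set nf_cayley I \<longleftrightarrow> (\<forall>u\<in>I. \<forall>v\<in>I. nf_mult v (nf_inv u) \<notin> nf_boundary)"
  by (auto simp: independent_set_def cayley_graph_def)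

lemma finite_nform: "finite (UNIV :: nform set)"
proof -
  have "(UNIV :: z3 set) = {Z0, Z1, Z2}" using z3.exhaust by blast
  then have "finite (UNIV :: z3 set)" by (metis finite.simps)
  then show ?thesis by (simp add: finite_prod)
qed

section \<open>The independence number\<close>

lemma not_nf_boundary_cases:
  assumes "g \<notin> nf_boundary" and "g \<noteq> (Z0, False, False)"
  shows "g \<in> {(Z0, True, False), (Z0, True, True), (Z1, False, True), (Z1, True, False),
    (Z2, True, False), (Z2, True, True)}"
proof -
  obtain i x y where "g = (i, x, y)" by (metis prod_cases3)
  with assms show ?thesis by (cases i; cases x; cases y) (simp_all add: nf_boundary_def)
qed

text \<open>The fourth element is e. Any three vertices of the wheel include two adjacent ones: the
  hub is joined to every rim vertex, and a 5-cycle has no independent triple. The proof checks all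
  triples.\<close>

lemma no_independent_quadruple:
  assumes "x \<noteq> (Z0, False, False)" "y \<noteq> (Z0, False, False)" "z \<noteq> (Z0, False, False)"
    and "x \<noteq> y" "x \<noteq> z" "y \<noteq> z"
    and "x \<notin> nf_boundary" "y \<notin> nf_boundary" "z \<notin> nf_boundary"
    and "nf_mult x (nf_inv y) \<notin> nf_boundary" "nf_mult x (nf_inv z) \<notin> nf_boundary"
      "nf_mult y (nf_inv z) \<notin> nf_boundary"
  shows False
proof -
  let ?N = "{(Z0, True, False), (Z0, True, True), (Z1, False, True), (Z1, True, False),
    (Z2, True, False), (Z2, True, True)}"
  have "x \<in> ?N" "y \<in> ?N" "z \<in> ?N"
    by (rule not_nf_boundary_cases; fact)+
  with assms(4-6,10-12) show False
    unfolding insert_iff empty_iff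
    by (elim disjE) (simp_all add: nf_boundary_def)
qed

text \<open>Adjacency depends only on this quotient, so right translations preserve it.\<close>

lemma (in group) quotient_right_translate:
  assumes "g \<in> carrier G" "h \<in> carrier G" "u \<in> carrier G"
  shows "(g \<otimes> inv u) \<otimes> inv (h \<otimes> inv u) = g \<otimes> inv h"
proof -
  have "inv u \<otimes> (u \<otimes> inv h) = inv h"
    using assms by (metis inv_closed l_inv l_one m_assoc)
  then show ?thesis using assms by (simp add: inv_mult_group m_assoc)
qed

lemma card_independent_set_nf_cayley:
  assumes "independent_set nf_cayley I"
  shows "card I \<le> 3"
proof (rule ccontr)
  assume "\<not> card I \<le> 3"
  then have "Suc 3 \<le> card I" by simp
  then obtain T where T: "T \<subseteq> I" "card T = Suc 3"
    by (rule obtain_subset_with_card_n)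
  then obtain u B where B: "T = insert u B" "u \<notin> B" "card B = 3"
    using card_eq_SucD by metis
  from \<open>card B = 3\<close> obtain x y z where xyz: "B = {x, y, z}" "x \<noteq> y" "x \<noteq> z" "y \<noteq> z"
    unfolding card_3_iff by blast
  have sub: "{u, x, y, z} \<subseteq> I" and ne: "x \<noteq> u" "y \<noteq> u" "z \<noteq> u"
    using T(1) B(1,2) xyz(1) by blast+
  \<comment> \<open>Right translation by u^-1 sends \<open>u\<close> to e and reduces to the case of
    a quadruple containing e.\<close>
  define r where "r g = nf_mult g (nf_inv u)" for g
  have r_eq: "r g = r h \<longleftrightarrow> g = h" for g h
    using nf.right_cancel[of "nf_inv u" g h] by (simp add: r_def)
  have r_u: "r u = (Z0, False, False)"
    using nf.r_inv[of u] by (simp add: r_def)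
  have r_quot: "nf_mult (r g) (nf_inv (r h)) = nf_mult g (nf_inv h)" for g h
    using nf.quotient_right_translate[of g h u] by (simp add: r_def)
  have adj: "nf_mult g (nf_inv h) \<notin> nf_boundary" if "g \<in> {u, x, y, z}" "h \<in> {u, x, y, z}" for g h
    using assms sub that unfolding independent_set_nf_cayley by blast
  have r_adj: "nf_mult (r g) (nf_inv (r h)) \<notin> nf_boundary"
    if "g \<in> {u, x, y, z}" "h \<in> {u, x, y, z}" for g h
    unfolding r_quot by (rule adj[OF that])
  have r_boundary: "r g \<notin> nf_boundary" if "g \<in> {u, x, y, z}" for g
    using adj[OF that, of u] unfolding r_def by blast
  have r_ne: "r g \<noteq> (Z0, False, False)" if "g \<noteq> u" for g
    using that unfolding r_u[symmetric] r_eq .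
  show False
    by (rule no_independent_quadruple[OF r_ne r_ne r_ne _ _ _ r_boundary r_boundary r_boundary
          r_adj r_adj r_adj, of x y z])
      (simp_all only: r_eq ne xyz insert_iff simp_thms)
qed

lemma independence_number_nf_cayley: "independence_number nf_cayley = 3"
proof -
  \<comment> \<open>The set {e, ab, tb}: e with two nonadjacent rim vertices.\<close>
  let ?I = "{(Z0, False, False), (Z0, True, True), (Z1, False, True)}"
  have "independent_set nf_cayley ?I"
    unfolding independent_set_nf_cayley by (simp add: nf_boundary_def)
  moreover have "card ?I = 3" by simp
  ultimately have "3 \<in> card ` {I. independent_set nf_cayley I}" by (force simp: image_iff)
  moreover have "finite {I. independent_set nf_cayley I}"
    using finite_nform by (metis Finite_Set.finite_set finite_subset subset_UNIV)
  ultimately show ?thesis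
    unfolding independence_number_def
    by (intro Max_eqI) (auto intro: card_independent_set_nf_cayley)
qed

section \<open>The independent domination number\<close>

lemma card_maximal_independent_set_nf_cayley:
  assumes "maximal_independent_set nf_cayley I"
  shows "2 \<le> card I"
proof -
  \<comment> \<open>The vertices u and au are not adjacent, because their quotient is the involution
    a, which lies outside the boundary. Hence neither the empty set nor a singleton is
    maximal.\<close>
  have indep: "independent_set nf_cayley {u, nf_mult (Z0, True, False) u}" for u
  proof -
    have "\<forall>u. independent_set nf_cayley {u, nf_mult (Z0, True, False) u}"
      unfolding independent_set_nf_cayley by (simp add: all_nform nf_boundary_def)
    then show ?thesis ..
  qed
  have max: "J = I" if "independent_set nf_cayley J" "I \<subseteq> J" for J
    using assms that by (simp add: maximal_independent_set_def)
  from max[OF indep] have "I \<noteq> {}" by force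
  then obtain u where u: "u \<in> I" by blast
  have ne: "nf_mult (Z0, True, False) u \<noteq> u"
  proof -
    have "\<forall>u. nf_mult (Z0, True, False) u \<noteq> u" by (simp add: all_nform)
    then show ?thesis ..
  qed
  have "I \<noteq> {u}" using max[OF indep[of u]] ne by blast
  then obtain v where "v \<in> I" "v \<noteq> u" using u by blast
  with u have "card {u, v} \<le> card I"
    by (intro card_mono finite_subset[OF subset_UNIV finite_nform]) auto
  with \<open>v \<noteq> u\<close> show ?thesis by simp
qed

lemma independent_domination_number_nf_cayley: "independent_domination_number nf_cayley = 2"
proof -
  let ?I = "{(Z0, False, False), (Z0, True, False)}"
  have indep: "independent_set nf_cayley ?I"
    unfolding independent_set_nf_cayley by (simp add: nf_boundary_def)
  \<comment> \<open>Every other vertex is adjacent to e or to a, so no independent set properly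
    contains {e, a}.\<close>
  have dominating: "\<forall>v. v \<notin> ?I \<longrightarrow> (\<exists>u\<in>?I. nf_mult v (nf_inv u) \<in> nf_boundary)"
    by (simp add: all_nform nf_boundary_def)
  have "J = ?I" if "independent_set nf_cayley J" "?I \<subseteq> J" for J
  proof (rule subset_antisym[OF subsetI that(2)], rule ccontr)
    fix v assume "v \<in> J" "v \<notin> ?I"
    with dominating obtain u where "u \<in> ?I" "nf_mult v (nf_inv u) \<in> nf_boundary" by meson
    moreover have "u \<in> J" using \<open>u \<in> ?I\<close> that(2) by (rule rev_subsetD)
    ultimately show False
      using \<open>v \<in> J\<close> that(1) by (simp only: independent_set_nf_cayley)
  qed
  with indep have "maximal_independent_set nf_cayley ?I"
    unfolding maximal_independent_set_def by blast
  moreover have "card ?I = 2" by simp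
  ultimately have "2 \<in> card ` {I. maximal_independent_set nf_cayley I}" by (force simp: image_iff)
  moreover have "finite {I. maximal_independent_set nf_cayley I}"
    using finite_nform by (metis Finite_Set.finite_set finite_subset subset_UNIV)
  ultimately show ?thesis
    unfolding independent_domination_number_def
    by (intro Min_eqI) (auto intro: card_maximal_independent_set_nf_cayley)
qed

theorem lemma13:
  fixes G :: "letter word set monoid" and A :: "letter word set set"
  assumes "G = presented_group G_relations"
    and "A = {\<one>\<^bsub>G\<^esub>, presented_gen G_relations gb, presented_gen G_relations gt}"
  shows "independent_domination_number (cayley_graph G (\<partial>\<^bsub>G\<^esub> A)) = 2 \<and>
    independence_number (cayley_graph G (\<partial>\<^bsub>G\<^esub> A)) = 3"
proof -
  interpret G: group G unfolding assms(1) by (rule group_presented_group)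
  let ?B = "{(Z0, False, False), (Z0, False, True), (Z1, False, False)}"
  obtain f where f: "f \<in> iso nf_group G" and
    f_def: "f = nf_eval G (presented_gen G_relations ga) (presented_gen G_relations gb)
      (presented_gen G_relations gt)"
    using nf_eval_iso assms(1) by simp
  \<comment> \<open>The explicit form of \<open>f\<close> is needed here: it sends the normal forms
    of e, b and t to the corresponding elements of \<open>G\<close>.\<close>
  have "A = f ` ?B"
    using presented_gen_closed[of G_relations] by (simp add: assms(2) f_def flip: assms(1))
  then have "\<partial>\<^bsub>G\<^esub> A = f ` nf_boundary"
    using quotient_boundary_iso[OF group_nf_group G.group_axioms f, of ?B]
    by (simp add: boundary_nf_group)
  then show ?thesis
    using cayley_graph_iso[OF group_nf_group G.group_axioms f, of nf_boundary]
    by (simp add: independence_number_nf_cayley independent_domination_number_nf_cayley)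
qed

end
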